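(* Let $m\ge 2$, $n=2^m$, let $\alpha_1,\dots,\alpha_n$ be an enumeration of all elements of $F^m=\{0,1\}^m$, and let $f:F^m\to F^m$ be a one-to-one APN operator. Let $$P=\Big\{x\in F^n:\sum_{i=1}^n x_i=0,\ \sum_{i=1}^n x_i\alpha_i=0^m\Big\},\qquad P'=\Big\{x\in F^n:\sum_{i=1}^n x_i=0,\ \sum_{i=1}^n x_i f(\alpha_i)=0^m\Big\},$$ and let $Q$ be an odd coset of $P'$, i.e. $Q=\{x\in F^n:\sum_{i} x_i=1,\ \sum_{i} x_i f(\alpha_i)=\beta\}$ for some $\beta\in F^m$. Then $R(P,Q)$ is a diameter perfect distance $5$ code in $X^n$.
   Context: $F^k=\{0,1\}^k$ is the set of binary words of length $k$, with coordinatewise addition mod $2$. $X^n$ is the set of words of length $n$ over the alphabet $\{0,1,*\}$ containing exactly one symbol $*$, so $|X^n|=n2^{n-1}$. The Hamming distance $d_H$ between two words of length $n$ over $\{0,1,*\}$ is the number of positions in which they differ. An operator $f:F^m\to F^m$ is APN (almost perfect nonlinear) if for every $(a,b)\ne(0^m,0^m)$ in $F^m\times F^m$ the system $x+y=a$, $f(x)+f(y)=b$ has $0$ or $2$ solutions $(x,y)\in F^m\times F^m$. A subset $C$ of a finite metric space $S$ is a distance $d$ code if $|C|\ge 2$ and $d$ is the minimal distance between two different words of $C$. A nonempty subset $A$ of $S$ is a diameter $D$ anticode if $D$ is the maximal distance between two words of $A$. If $C$ is a distance $d$ code and $A$ is a diameter $D$ anticode with $D<d$, then (when the isometry group of $S$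 is transitive, as it is for $X^n$) $|C|\cdot|A|\le|S|$. A distance $d$ code $C$ is diameter perfect if $|C|\cdot|A|=|S|$ for some diameter $D$ anticode $A$ with $D<d$. Here $P$ and $P'$ are extended Hamming codes of length $n$ (the second with the enumeration $f(\alpha_1),\dots,f(\alpha_n)$ of $F^m$). For each $p\in P$ there is a unique $q(p)\in Q$ with $d_H(p,q(p))=1$. Let $r(p)\in X^n$ be the word obtained from $p$ by writing $*$ in the unique coordinate where $p$ and $q(p)$ differ. Then $R(P,Q)=\{r(p): p\in P\}\subset X^n$. *)

theory Defs
  imports Complex_Main "HOL-Library.Z2" "HOL-Library.FuncSet"
begin

type_synonym word = "bit list"

definition F :: "nat \<Rightarrow> word set" where
  "F k = {x. length x = k}"

definition zero_word :: "nat \<Rightarrow> word" where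
  "zero_word k = replicate k 0"

definition add_word :: "word \<Rightarrow> word \<Rightarrow> word" where
  "add_word x y = map2 (+) x y"

text \<open>Words over the alphabet \<open>{0, 1, *}\<close> are lists over \<open>bit option\<close>, with \<open>None\<close> as the
  symbol \<open>*\<close>.\<close>

definition X :: "nat \<Rightarrow> bit option list set" where
  "X n = {w. length w = n \<and> count_list w None = 1}"

text \<open>The Hamming distance is only meant for words of equal length.\<close>

definition hamming :: "'a list \<Rightarrow> 'a list \<Rightarrow> nat" where
  "hamming x y = card {i. i < length x \<and> x ! i \<noteq> y ! i}"

definition APN :: "nat \<Rightarrow> (word \<Rightarrow> word) \<Rightarrow> bool" where
  "APN m f \<longleftrightarrow> f \<in> F m \<rightarrow> F m \<and>
     (\<forall>a\<in>F m. \<forall>b\<in>F m. (a, b) \<noteq> (zero_word m, zero_word m) \<longrightarrow>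
        card {(x, y) \<in> F m \<times> F m. add_word x y = a \<and> add_word (f x) (f y) = b} \<in> {0, 2})"

text \<open>In the following three definitions, a finite metric space is given by its finite set of
  points \<open>S\<close> and its distance function \<open>d\<close>.\<close>

definition distance_code :: "'a set \<Rightarrow> ('a \<Rightarrow> 'a \<Rightarrow> 'd::linorder) \<Rightarrow> 'd \<Rightarrow> 'a set \<Rightarrow> bool" where
  "distance_code S d \<delta> C \<longleftrightarrow>
     C \<subseteq> S \<and> card C \<ge> 2 \<and> \<delta> = Min {d x y | x y. x \<in> C \<and> y \<in> C \<and> x \<noteq> y}"

definition diameter_anticode :: "'a set \<Rightarrow> ('a \<Rightarrow> 'a \<Rightarrow> 'd::linorder) \<Rightarrow> 'd \<Rightarrow> 'a set \<Rightarrow> bool" where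
  "diameter_anticode S d D A \<longleftrightarrow>
     A \<subseteq> S \<and> A \<noteq> {} \<and> D = Max {d x y | x y. x \<in> A \<and> y \<in> A}"

definition diameter_perfect_code :: "'a set \<Rightarrow> ('a \<Rightarrow> 'a \<Rightarrow> 'd::linorder) \<Rightarrow> 'd \<Rightarrow> 'a set \<Rightarrow> bool" where
  "diameter_perfect_code S d \<delta> C \<longleftrightarrow> distance_code S d \<delta> C \<and>
     (\<exists>A D. diameter_anticode S d D A \<and> D < \<delta> \<and> card C * card A = card S)"

text \<open>The vector \<open>\<Sum>i. x\<^sub>i h\<^sub>i\<close> in \<open>F m\<close>; coordinates of \<open>x \<in> F n\<close> are numbered \<open>0, \<dots>, n - 1\<close>.\<close>

definition syndrome :: "nat \<Rightarrow> nat \<Rightarrow> (nat \<Rightarrow> word) \<Rightarrow> word \<Rightarrow> word" where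
  "syndrome m n h x = map (\<lambda>j. \<Sum>i<n. x ! i * h i ! j) [0..<m]"

definition ext_hamming :: "nat \<Rightarrow> nat \<Rightarrow> (nat \<Rightarrow> word) \<Rightarrow> word set" where
  "ext_hamming m n h = {x \<in> F n. (\<Sum>i<n. x ! i) = 0 \<and> syndrome m n h x = zero_word m}"

definition odd_coset :: "nat \<Rightarrow> nat \<Rightarrow> (nat \<Rightarrow> word) \<Rightarrow> word \<Rightarrow> word set" where
  "odd_coset m n h \<beta> = {x \<in> F n. (\<Sum>i<n. x ! i) = 1 \<and> syndrome m n h x = \<beta>}"

definition neighbour :: "word set \<Rightarrow> word \<Rightarrow> word" where
  "neighbour Q p = (THE q. q \<in> Q \<and> hamming p q = 1)"

definition star_diff :: "word \<Rightarrow> word \<Rightarrow> bit option list" where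
  "star_diff p q = (map Some p)[(THE i. i < length p \<and> p ! i \<noteq> q ! i) := None]"

definition R :: "word set \<Rightarrow> word set \<Rightarrow> bit option list set" where
  "R P Q = {star_diff p (neighbour Q p) | p. p \<in> P}"

text \<open>The sets \<^const>\<open>odd_coset\<close> are exactly the translates of the extended Hamming code
  by words of odd weight.\<close>

lemma length_add_word: "\<lbrakk>x \<in> F k; y \<in> F k\<rbrakk> \<Longrightarrow> add_word x y \<in> F k"
  by (simp add: F_def add_word_def)

lemma nth_add_word: "\<lbrakk>x \<in> F k; y \<in> F k; i < k\<rbrakk> \<Longrightarrow> add_word x y ! i = x ! i + y ! i"
  by (simp add: F_def add_word_def)

lemma sum_add_word:
  assumes "x \<in> F n" "y \<in> F n"
  shows "(\<Sum>i<n. add_word x y ! i) = (\<Sum>i<n. x ! i) + (\<Sum>i<n. y ! i)"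
proof -
  have "(\<Sum>i<n. add_word x y ! i) = (\<Sum>i<n. x ! i + y ! i)"
    by (rule sum.cong) (use assms in \<open>auto simp: nth_add_word\<close>)
  then show ?thesis by (simp only: sum.distrib)
qed

lemma syndrome_add_word:
  assumes "x \<in> F n" "y \<in> F n"
  shows "syndrome m n h (add_word x y) = add_word (syndrome m n h x) (syndrome m n h y)"
proof (rule nth_equalityI)
  show "length (syndrome m n h (add_word x y)) =
      length (add_word (syndrome m n h x) (syndrome m n h y))"
    by (simp add: syndrome_def add_word_def)
next
  fix j assume "j < length (syndrome m n h (add_word x y))"
  then have j: "j < m" by (simp add: syndrome_def)
  have "(\<Sum>i<n. add_word x y ! i * h i ! j) = (\<Sum>i<n. x ! i * h i ! j + y ! i * h i ! j)"
    by (rule sum.cong) (use assms in \<open>auto simp: nth_add_word[where k = n] distrib_right\<close>)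
  then have "(\<Sum>i<n. add_word x y ! i * h i ! j) =
      (\<Sum>i<n. x ! i * h i ! j) + (\<Sum>i<n. y ! i * h i ! j)"
    by (simp only: sum.distrib)
  with j show "syndrome m n h (add_word x y) ! j =
      add_word (syndrome m n h x) (syndrome m n h y) ! j"
    by (simp add: syndrome_def add_word_def)
qed

lemma add_word_self: "x \<in> F k \<Longrightarrow> add_word x x = zero_word k"
  by (rule nth_equalityI) (auto simp: F_def add_word_def zero_word_def)

lemma add_word_zero: "x \<in> F k \<Longrightarrow> add_word x (zero_word k) = x"
  by (rule nth_equalityI) (auto simp: F_def add_word_def zero_word_def)

lemma add_word_cancel: "\<lbrakk>x \<in> F k; y \<in> F k\<rbrakk> \<Longrightarrow> add_word x (add_word x y) = y"
  by (rule nth_equalityI) (auto simp: F_def add_word_def simp flip: add.assoc)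

lemma syndrome_in_F: "syndrome m n h x \<in> F m"
  by (simp add: syndrome_def F_def)

lemma odd_coset_eq_translate:
  assumes u: "u \<in> F n" "(\<Sum>i<n. u ! i) = 1"
  shows "odd_coset m n h (syndrome m n h u) = add_word u ` ext_hamming m n h"
proof (intro equalityI subsetI)
  fix x assume "x \<in> odd_coset m n h (syndrome m n h u)"
  then have x: "x \<in> F n" "(\<Sum>i<n. x ! i) = 1" "syndrome m n h x = syndrome m n h u"
    by (auto simp: odd_coset_def)
  have "add_word u x \<in> ext_hamming m n h"
    unfolding ext_hamming_def mem_Collect_eq sum_add_word[OF u(1) x(1)]
      syndrome_add_word[OF u(1) x(1)] x(2,3) u(2)
    using u x length_add_word add_word_self[OF syndrome_in_F] by auto
  then show "x \<in> add_word u ` ext_hamming m n h"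
    using add_word_cancel[OF u(1) x(1)] by (metis imageI)
next
  fix x assume "x \<in> add_word u ` ext_hamming m n h"
  then obtain y where y: "x = add_word u y" "y \<in> F n" "(\<Sum>i<n. y ! i) = 0"
      "syndrome m n h y = zero_word m"
    by (auto simp: ext_hamming_def)
  show "x \<in> odd_coset m n h (syndrome m n h u)"
    unfolding odd_coset_def mem_Collect_eq y(1) sum_add_word[OF u(1) y(2)]
      syndrome_add_word[OF u(1) y(2)] y(3,4) u(2)
    using u y length_add_word add_word_zero[OF syndrome_in_F] by auto
qed

lemma odd_coset_translate_ex:
  assumes "bij_betw h {..<n} (F m)" "\<beta> \<in> F m"
  shows "\<exists>u\<in>F n. (\<Sum>i<n. u ! i) = 1 \<and> odd_coset m n h \<beta> = add_word u ` ext_hamming m n h"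
proof -
  obtain k where k: "k < n" "h k = \<beta>"
    using assms by (metis bij_betw_imp_surj_on imageE lessThan_iff)
  define u :: word where "u = map (\<lambda>i. if i = k then 1 else 0) [0..<n]"
  have u: "u \<in> F n" "\<And>i. i < n \<Longrightarrow> u ! i = (if i = k then 1 else 0)"
    by (auto simp: u_def F_def)
  have "(\<Sum>i<n. u ! i) = (\<Sum>i<n. if i = k then 1 else 0)"
    by (rule sum.cong) (auto simp: u)
  also have "\<dots> = 1" using k by (simp add: sum.delta)
  finally have 1: "(\<Sum>i<n. u ! i) = 1" .
  have "(\<Sum>i<n. u ! i * h i ! j) = \<beta> ! j" for j
  proof -
    have "(\<Sum>i<n. u ! i * h i ! j) = (\<Sum>i<n. if i = k then h i ! j else 0)"
      by (rule sum.cong) (auto simp: u)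
    then show ?thesis using k by (simp add: sum.delta)
  qed
  then have "syndrome m n h u = \<beta>"
    using assms(2) by (intro nth_equalityI) (auto simp: syndrome_def F_def)
  then show ?thesis using odd_coset_eq_translate[OF u(1) 1] u(1) 1 by metis
qed

end

theory Submission imports Defs begin

text \<open>
  Two words of \<open>F n\<close> have the same parity and the same syndrome exactly when the set \<open>D\<close> of
  positions where they differ is an even dependency: \<open>D\<close> has even size and the columns \<open>h i\<close>,
  \<open>i \<in> D\<close>, add up to zero. If the columns are distinct, nonempty even dependencies have at least
  four elements, so an extended Hamming code and its cosets have minimal distance at least 4.
  The APN property of \<open>f\<close> says that no 4-set is an even dependency for the columns \<open>\<alpha> i\<close> and for
  the columns \<open>f (\<alpha> i)\<close> at the same time.

  The codewords are the words \<open>star i p\<close> with \<open>p \<in> P\<close> such that \<open>p\<close> with bit \<open>i\<close> flipped lies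
  in \<open>Q\<close>. Let \<open>star i p\<close> and \<open>star i' p'\<close> be two of them with \<open>p \<noteq> p'\<close>, and let \<open>p\<close> and \<open>p'\<close>
  differ exactly on \<open>D\<close>. Their distance is \<open>card (D - {i})\<close> if \<open>i = i'\<close> and
  \<open>card (D \<union> {i, i'})\<close> otherwise. As \<open>card D\<close> is even and at least 4, only \<open>card D = 4\<close> can
  give less than 5. Then \<open>i = i'\<close> is impossible, since the two words of \<open>Q\<close> would also differ
  on \<open>D\<close>, against the APN property; and \<open>{i, i'} \<subseteq> D\<close> is impossible, since the two words of \<open>Q\<close>
  would have distance 2. So \<open>D \<union> {i, i'}\<close> has at least five elements
  (\<open>hamming_star_ge_5\<close>). If \<open>D\<close> is a 4-set containing \<open>i\<close>, it has at most five, so the bound is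
  attained (\<open>hamming_star_eq_5_attained\<close>).

  For perfectness, the words with the star in position \<open>i\<close> and at most one symbol 1 elsewhere,
  for all \<open>i\<close>, form an anticode of size \<open>n\<^sup>2\<close>: two of them differ at most in the two star
  positions and the two positions of a 1. On the other hand \<open>card (X n)\<close> is \<open>n\<close> times
  the number of odd words (place the star; the parity recovers the lost bit), and the number of
  odd words is \<open>n\<close> times \<open>card P\<close> (every odd word has exactly one neighbour in \<open>P\<close>).
\<close>

\<comment> \<open>By default the simplifier turns \<open>+\<close> and \<open>*\<close> on bits into bit operations, which blocks the ring
  laws.\<close>
declare add_bit_eq_xor [simp del] mult_bit_eq_and [simp del]

section \<open>Even dependencies\<close>

definition differ :: "'a list \<Rightarrow> 'a list \<Rightarrow> nat set" where
  "differ x y = {i. i < length x \<and> x ! i \<noteq> y ! i}"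

definition even_dependency :: "nat \<Rightarrow> (nat \<Rightarrow> word) \<Rightarrow> nat set \<Rightarrow> bool" where
  "even_dependency m h S \<longleftrightarrow> finite S \<and> even (card S) \<and> (\<forall>j<m. (\<Sum>i\<in>S. h i ! j) = 0)"

lemma finite_F: "finite (F n)"
proof -
  have "x \<in> {0, 1}" for x :: bit by (cases x) simp_all
  then have "F n = {x. set x \<subseteq> {0, 1} \<and> length x = n}" by (auto simp: F_def)
  then show ?thesis by (simp add: finite_lists_length_eq)
qed

lemma finite_differ [simp]: "finite (differ x y)"
  by (simp add: differ_def)

lemma hamming_eq_card_differ: "hamming x y = card (differ x y)"
  by (simp add: hamming_def differ_def)

lemma differ_empty_iff: "length x = length y \<Longrightarrow> differ x y = {} \<longleftrightarrow> x = y"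
  by (auto simp: differ_def list_eq_iff_nth_eq)

lemma bit_add_eq_0_iff: "a + b = 0 \<longleftrightarrow> a = (b::bit)"
  by (cases a; cases b) auto

lemma bit_add_1_eq_iff: "a + 1 = b \<longleftrightarrow> a \<noteq> b" "b = a + 1 \<longleftrightarrow> a \<noteq> b" for a b :: bit
  by (cases a; cases b; simp)+

lemma of_nat_bit_eq_0_iff: "(of_nat k :: bit) = 0 \<longleftrightarrow> even k"
proof (induction k)
  case (Suc k)
  then show ?case by (cases "of_nat k :: bit") simp_all
qed simp

lemma weighted_sums_eq_iff:
  fixes x y :: word and c :: "nat \<Rightarrow> bit"
  assumes "x \<in> F n"
  shows "(\<Sum>i<n. x ! i * c i) = (\<Sum>i<n. y ! i * c i) \<longleftrightarrow> (\<Sum>i\<in>differ x y. c i) = 0"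
proof -
  have "(\<Sum>i<n. x ! i * c i) + (\<Sum>i<n. y ! i * c i) = (\<Sum>i<n. (x ! i + y ! i) * c i)"
    by (simp only: sum.distrib distrib_right)
  also have "\<dots> = (\<Sum>i<n. if x ! i \<noteq> y ! i then c i else 0)"
  proof (rule sum.cong)
    fix i
    show "(x ! i + y ! i) * c i = (if x ! i \<noteq> y ! i then c i else 0)"
      by (cases "x ! i"; cases "y ! i") auto
  qed simp
  also have "\<dots> = (\<Sum>i\<in>{i\<in>{..<n}. x ! i \<noteq> y ! i}. c i)"
    by (simp only: sum.inter_filter[OF finite_lessThan])
  also have "{i\<in>{..<n}. x ! i \<noteq> y ! i} = differ x y"
    using assms by (auto simp: differ_def F_def)
  finally show ?thesis by (metis bit_add_eq_0_iff)
qed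

lemma even_dependency_differ_iff:
  assumes "x \<in> F n"
  shows "even_dependency m h (differ x y) \<longleftrightarrow>
    (\<Sum>i<n. x ! i) = (\<Sum>i<n. y ! i) \<and> syndrome m n h x = syndrome m n h y"
proof -
  have "(\<Sum>i<n. x ! i) = (\<Sum>i<n. y ! i) \<longleftrightarrow> even (card (differ x y))"
    using weighted_sums_eq_iff[OF assms, of "\<lambda>_. 1" y] by (simp add: of_nat_bit_eq_0_iff)
  moreover have "syndrome m n h x = syndrome m n h y \<longleftrightarrow>
      (\<forall>j<m. (\<Sum>i<n. x ! i * h i ! j) = (\<Sum>i<n. y ! i * h i ! j))"
    unfolding syndrome_def map_eq_conv by auto
  then have "syndrome m n h x = syndrome m n h y \<longleftrightarrow>
      (\<forall>j<m. (\<Sum>i\<in>differ x y. h i ! j) = 0)"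
    by (simp only: weighted_sums_eq_iff[OF assms])
  ultimately show ?thesis unfolding even_dependency_def using finite_differ by blast
qed

text \<open>The size is even, and a dependency \<open>{a, b}\<close> would mean \<open>h a = h b\<close>.\<close>

lemma even_dependency_card_ge_4:
  assumes dep: "even_dependency m h S" and "S \<noteq> {}" and inj: "inj_on h S" and h: "h ` S \<subseteq> F m"
  shows "card S \<ge> 4"
proof (rule ccontr)
  assume "\<not> card S \<ge> 4"
  moreover have "card S \<noteq> 0" "even (card S)" "card S \<noteq> 3" "card S \<noteq> 1"
    using dep \<open>S \<noteq> {}\<close> by (auto simp: even_dependency_def)
  ultimately have "card S = 2" by linarith
  then obtain a b where S: "S = {a, b}" "a \<noteq> b" by (meson card_2_iff)
  have "h a = h b"
    using dep h unfolding S
    by (intro nth_equalityI) (auto simp: even_dependency_def S F_def bit_add_eq_0_iff)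
  then show False using inj S by (auto dest: inj_onD)
qed

text \<open>If \<open>S = {a, b, c, d}\<close> were an even dependency both before and after applying \<open>f\<close>, the pairs
  \<open>(h a, h b)\<close>, \<open>(h b, h a)\<close> and \<open>(h c, h d)\<close> would be three solutions of one APN system.\<close>

lemma APN_no_common_even_dependency:
  assumes APN: "APN m f" and inj: "inj_on h S" and h: "h ` S \<subseteq> F m"
    and dep: "even_dependency m h S" and depf: "even_dependency m (\<lambda>i. f (h i)) S"
  shows "card S \<noteq> 4"
proof
  assume "card S = 4"
  then obtain a b c d where S: "S = {a, b, c, d}"
    and dist: "distinct [a, b, c, d]"
    by (auto simp: card_Suc_eq numeral_eq_Suc)
  have f: "f x \<in> F m" if "x \<in> F m" for x using APN that by (auto simp: APN_def)
  have hF: "h a \<in> F m" "h b \<in> F m" "h c \<in> F m" "h d \<in> F m" using h S by auto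
  have hne: "h a \<noteq> h b" "h a \<noteq> h c" "h b \<noteq> h c"
    using inj dist S by (auto simp: inj_on_def)
  have pair: "add_word (g a) (g b) = add_word (g c) (g d)"
    if "even_dependency m g S" "g a \<in> F m" "g b \<in> F m" "g c \<in> F m" "g d \<in> F m" for g
  proof (rule nth_equalityI)
    fix j assume "j < length (add_word (g a) (g b))"
    then have j: "j < m" using that by (simp add: add_word_def F_def)
    have "(\<Sum>i\<in>S. g i ! j) = 0" using that(1) j by (simp add: even_dependency_def)
    then have "g a ! j + g b ! j + (g c ! j + g d ! j) = 0" using dist by (simp add: S add.assoc)
    then have "g a ! j + g b ! j = g c ! j + g d ! j" by (simp only: bit_add_eq_0_iff)
    then show "add_word (g a) (g b) ! j = add_word (g c) (g d) ! j"
      using that j by (simp add: nth_add_word[of _ m])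
  qed (use that in \<open>simp add: F_def add_word_def\<close>)
  define A where "A = add_word (h a) (h b)"
  define B where "B = add_word (f (h a)) (f (h b))"
  define T where "T = {(x, y) \<in> F m \<times> F m. add_word x y = A \<and> add_word (f x) (f y) = B}"
  have comm: "add_word x y = add_word y x" if "x \<in> F m" "y \<in> F m" for x y
    using that by (intro nth_equalityI) (auto simp: F_def add_word_def add.commute)
  have sub: "{(h a, h b), (h b, h a), (h c, h d)} \<subseteq> T"
    using pair[OF dep hF] pair[OF depf] hF f comm by (auto simp: T_def A_def B_def)
  have "A \<noteq> zero_word m"
  proof
    assume "A = zero_word m"
    then have "h b = h a"
      using add_word_cancel[OF hF(1,2)] add_word_zero[OF hF(1)] by (simp add: A_def)
    then show False using hne by simp
  qed
  then have "card T \<in> {0, 2}"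
    using APN hF f length_add_word unfolding APN_def T_def A_def B_def by blast
  moreover have "finite T"
    by (rule finite_subset[of _ "F m \<times> F m"]) (auto simp: T_def finite_F)
  then have "card {(h a, h b), (h b, h a), (h c, h d)} \<le> card T"
    using sub by (rule card_mono)
  moreover have "card {(h a, h b), (h b, h a), (h c, h d)} = 3" using hne by auto
  ultimately show False by auto
qed

section \<open>Flipping one coordinate\<close>

definition flip :: "nat \<Rightarrow> word \<Rightarrow> word" where
  "flip i x = x[i := x ! i + 1]"

lemma length_flip [simp]: "length (flip i x) = length x"
  by (simp add: flip_def)

lemma flip_in_F [simp]: "flip i x \<in> F n \<longleftrightarrow> x \<in> F n"
  by (simp add: F_def)

lemma nth_flip: "k < length x \<Longrightarrow> flip i x ! k = (if k = i then x ! k + 1 else x ! k)"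
  by (auto simp: flip_def nth_list_update)

lemma flip_flip [simp]: "flip i (flip i x) = x"
  by (cases "i < length x") (simp_all add: flip_def list_update_beyond add.assoc)

lemma differ_flip: "i < length x \<Longrightarrow> differ x (flip i x) = {i}"
  by (auto simp: differ_def nth_flip split: if_splits)

lemma differ_flip_flip:
  assumes "i < length x" "i' < length x" "length y = length x"
  shows "differ (flip i x) (flip i' y) =
    (if i = i' then differ x y else (differ x y - {i, i'}) \<union> ({i, i'} - differ x y))"
  using assms by (auto simp: differ_def nth_flip bit_add_1_eq_iff split: if_splits)

lemma hamming_1_iff_flip:
  assumes "length y = length x"
  shows "hamming x y = 1 \<longleftrightarrow> (\<exists>i<length x. y = flip i x)"
proof
  assume "hamming x y = 1"
  then obtain i where i: "differ x y = {i}"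
    by (auto simp: hamming_eq_card_differ card_1_singleton_iff)
  have "y = flip i x"
  proof (rule nth_equalityI)
    fix k assume "k < length y"
    then have k: "k < length x" "x ! k \<noteq> y ! k \<longleftrightarrow> k = i"
      using i assms by (auto simp: differ_def)
    then show "y ! k = flip i x ! k"
      by (cases "x ! k"; cases "y ! k") (auto simp: nth_flip)
  qed (simp add: assms)
  moreover have "i < length x" using i by (auto simp: differ_def)
  ultimately show "\<exists>i<length x. y = flip i x" by blast
qed (auto simp: hamming_eq_card_differ differ_flip)

lemma sum_flip:
  assumes "x \<in> F n" "i < n"
  shows "(\<Sum>k<n. flip i x ! k * c k) = (\<Sum>k<n. x ! k * c k) + (c i :: bit)"
proof -
  have "(\<Sum>k<n. flip i x ! k * c k) = (\<Sum>k<n. x ! k * c k + (if k = i then c k else 0))"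
    by (rule sum.cong) (use assms in \<open>auto simp: nth_flip F_def distrib_right\<close>)
  then show ?thesis using assms by (simp add: sum.distrib)
qed

lemma parity_flip:
  assumes "x \<in> F n" "i < n"
  shows "(\<Sum>k<n. flip i x ! k) = (\<Sum>k<n. x ! k) + 1"
  using sum_flip[OF assms, of "\<lambda>_. 1"] by simp

lemma syndrome_flip:
  assumes "x \<in> F n" "i < n" "h i \<in> F m"
  shows "syndrome m n h (flip i x) = add_word (syndrome m n h x) (h i)"
  using assms by (intro nth_equalityI) (auto simp: syndrome_def F_def add_word_def sum_flip)

lemma syndrome_flip_eq_iff:
  assumes "x \<in> F n" "i < n" "h i \<in> F m" "t \<in> F m"
  shows "syndrome m n h (flip i x) = t \<longleftrightarrow> h i = add_word (syndrome m n h x) t"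
  using syndrome_flip[of x n i h m] assms add_word_cancel syndrome_in_F by metis

text \<open>Flipping bit \<open>i\<close> adds the column \<open>h i\<close> to the syndrome, and every element of \<open>F m\<close> is exactly
  one column. This one fact gives the unique neighbour in \<open>Q\<close> of a word of \<open>P\<close>, and the
  unique neighbour in \<open>P\<close> of an odd word.\<close>

lemma unique_flip_with_syndrome:
  assumes "bij_betw h {..<n} (F m)" "x \<in> F n" "t \<in> F m"
  shows "\<exists>!i. i < n \<and> syndrome m n h (flip i x) = t"
proof -
  have "syndrome m n h (flip i x) = t \<longleftrightarrow> h i = add_word (syndrome m n h x) t" if "i < n" for i
    using that assms by (intro syndrome_flip_eq_iff) (auto simp: bij_betw_def)
  moreover have "add_word (syndrome m n h x) t \<in> F m"
    by (intro length_add_word syndrome_in_F assms)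
  then obtain i where "i < n" "h i = add_word (syndrome m n h x) t"
    using assms(1) by (metis bij_betw_imp_surj_on imageE lessThan_iff)
  moreover have "i = j" if "i < n" "j < n" "h i = h j" for i j
    using assms(1) that by (auto simp: bij_betw_def inj_on_def)
  ultimately show ?thesis by (intro ex1I[of _ i]) metis+
qed

section \<open>Words with a star\<close>

definition star :: "nat \<Rightarrow> word \<Rightarrow> bit option list" where
  "star i x = (map Some x)[i := None]"

lemma length_star [simp]: "length (star i x) = length x"
  by (simp add: star_def)

lemma nth_star: "k < length x \<Longrightarrow> star i x ! k = (if k = i then None else Some (x ! k))"
  by (auto simp: star_def nth_list_update)

lemma differ_star:
  assumes "i < length x" "i' < length x" "length y = length x"
  shows "differ (star i x) (star i' y) =
    (if i = i' then differ x y - {i} else differ x y \<union> {i, i'})"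
  using assms by (auto simp: differ_def nth_star split: if_splits)

lemma in_X_iff: "w \<in> X n \<longleftrightarrow> length w = n \<and> (\<exists>!i. i < n \<and> w ! i = None)"
proof -
  have "count_list w None = card {i. i < length w \<and> w ! i = None}"
    by (simp add: count_list_eq_length_filter length_filter_conv_card eq_commute)
  moreover have "card A = 1 \<longleftrightarrow> (\<exists>!i. i \<in> A)" for A :: "nat set"
    by (simp add: card_1_singleton_iff) blast
  ultimately show ?thesis by (auto simp: X_def)
qed

lemma star_in_X: "x \<in> F n \<Longrightarrow> i < n \<Longrightarrow> star i x \<in> X n"
  by (auto simp: in_X_iff F_def nth_star split: if_splits)

lemma star_diff_flip: "i < length p \<Longrightarrow> star_diff p (flip i p) = star i p"
  unfolding star_diff_def star_def by (simp add: nth_flip cong: conj_cong)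

text \<open>The star hides one bit only, and the parity determines it.\<close>

lemma star_eq_iff_of_same_parity:
  assumes "x \<in> F n" "y \<in> F n" "i < n" "i' < n" "(\<Sum>k<n. x ! k) = (\<Sum>k<n. y ! k)"
  shows "star i x = star i' y \<longleftrightarrow> i = i' \<and> x = y"
proof
  assume eq: "star i x = star i' y"
  have len: "length x = n" "length y = n" using assms by (auto simp: F_def)
  have "differ (star i x) (star i' y) = {}" by (simp add: eq differ_def)
  then have "i = i'" and D: "differ x y \<subseteq> {i}"
    using differ_star[of i x i' y] assms len by (auto split: if_splits)
  \<comment> \<open>For words of length 0 as columns there are no syndrome conditions, only parity is left.\<close>
  moreover have "even (card (differ x y))"
    using even_dependency_differ_iff[OF assms(1), of 0 "\<lambda>_. []" y] assms(5)
    by (simp add: even_dependency_def syndrome_def)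
  then have "differ x y \<noteq> {i}" by auto
  then have "differ x y = {}" using D by blast
  ultimately show "i = i' \<and> x = y" using differ_empty_iff[of x y] len by simp
qed simp

section \<open>Counting\<close>

lemma card_X: "card (X n) = n * card {x \<in> F n. (\<Sum>i<n. x ! i) = 1}"
proof -
  let ?W = "{x \<in> F n. (\<Sum>i<n. x ! i) = 1}"
  have "bij_betw (\<lambda>(i, x). star i x) ({..<n} \<times> ?W) (X n)"
    unfolding bij_betw_def
  proof
    show "inj_on (\<lambda>(i, x). star i x) ({..<n} \<times> ?W)"
      by (auto simp: inj_on_def star_eq_iff_of_same_parity)
    show "(\<lambda>(i, x). star i x) ` ({..<n} \<times> ?W) = X n"
    proof (intro equalityI subsetI)
      fix w assume w: "w \<in> X n"
      then obtain i where i: "i < n" "\<And>k. k < n \<Longrightarrow> w ! k = None \<longleftrightarrow> k = i"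
        by (auto simp: in_X_iff)
      \<comment> \<open>The default 0 at the star may give the wrong parity, in which case it is flipped.\<close>
      define y where "y = map (case_option 0 id) w"
      have y: "y \<in> F n" using w by (simp add: y_def F_def in_X_iff)
      have *: "w = star i z" if "z = y \<or> z = flip i y" for z
        using that i w by (intro nth_equalityI)
          (auto simp: in_X_iff y_def nth_star nth_flip split: option.split)
      define x where "x = (if (\<Sum>k<n. y ! k) = 1 then y else flip i y)"
      have "x \<in> ?W" using y i(1) by (auto simp: x_def parity_flip)
      moreover have "w = star i x" by (rule *) (simp add: x_def)
      ultimately show "w \<in> (\<lambda>(i, x). star i x) ` ({..<n} \<times> ?W)" using i(1) by auto
    qed (auto intro: star_in_X)
  qed
  from bij_betw_same_card[OF this] show ?thesis by (simp add: card_cartesian_product)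
qed

lemma card_odd_words:
  assumes h: "bij_betw h {..<n} (F m)"
  shows "card {x \<in> F n. (\<Sum>i<n. x ! i) = 1} = n * card (ext_hamming m n h)"
proof -
  let ?W = "{x \<in> F n. (\<Sum>i<n. x ! i) = 1}"
  have zF: "zero_word m \<in> F m" by (simp add: F_def zero_word_def)
  have "bij_betw (\<lambda>(i, p). flip i p) ({..<n} \<times> ext_hamming m n h) ?W"
    unfolding bij_betw_def
  proof
    show "inj_on (\<lambda>(i, p). flip i p) ({..<n} \<times> ext_hamming m n h)"
    proof -
      have "i = i' \<and> p = p'"
        if i: "i < n" "i' < n" and p: "p \<in> ext_hamming m n h" "p' \<in> ext_hamming m n h"
          and eq: "flip i p = flip i' p'" for i p i' p'
      proof -
        have 1: "flip i p \<in> F n" using p by (simp add: ext_hamming_def)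
        have "syndrome m n h (flip i (flip i p)) = zero_word m"
             "syndrome m n h (flip i' (flip i p)) = zero_word m"
          using p by (simp_all add: ext_hamming_def) (simp add: eq)
        then have "i = i'" using unique_flip_with_syndrome[OF h 1 zF] i by blast
        then show "i = i' \<and> p = p'" using eq flip_flip by metis
      qed
      then show ?thesis by (auto simp: inj_on_def)
    qed
    show "(\<lambda>(i, p). flip i p) ` ({..<n} \<times> ext_hamming m n h) = ?W"
    proof (intro equalityI subsetI)
      fix x assume "x \<in> ?W"
      then obtain i where "i < n" "flip i x \<in> ext_hamming m n h"
        using unique_flip_with_syndrome[OF h _ zF, of x] by (auto simp: ext_hamming_def parity_flip)
      then show "x \<in> (\<lambda>(i, p). flip i p) ` ({..<n} \<times> ext_hamming m n h)"
        by (intro image_eqI[of _ _ "(i, flip i x)"]) auto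
    qed (auto simp: ext_hamming_def parity_flip)
  qed
  from bij_betw_same_card[OF this] show ?thesis by (simp add: card_cartesian_product)
qed

section \<open>The anticode\<close>

lemma diameter_at_most_4_anticode_in_X:
  assumes "n > 0"
  shows "\<exists>A D. diameter_anticode (X n) hamming D A \<and> D \<le> 4 \<and> card A = n ^ 2"
proof -
  \<comment> \<open>The star stands at \<open>i\<close> and the only 1 at \<open>j\<close>; for \<open>j = i\<close> the star hides the 1, which gives
    the word without any 1.\<close>
  define g where "g i j = star i (map (\<lambda>k. of_bool (k = j)) [0..<n])" for i j
  have len: "length (g i j) = n" for i j by (simp add: g_def)
  have nth: "g i j ! k = (if k = i then None else Some (of_bool (k = j)))" if "k < n" for i j k
    using that by (simp add: g_def nth_star)
  define A where "A = (\<lambda>(i, j). g i j) ` ({..<n} \<times> {..<n})"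
  have close: "hamming (g i j) (g i' j') \<le> 4" for i j i' j'
  proof -
    have "differ (g i j) (g i' j') \<subseteq> set [i, j, i', j']"
      by (auto simp: differ_def nth len split: if_splits)
    then have "card (differ (g i j) (g i' j')) \<le> card (set [i, j, i', j'])"
      by (intro card_mono) auto
    also have "\<dots> \<le> 4" using card_length[of "[i, j, i', j']"] by simp
    finally show ?thesis by (simp add: hamming_eq_card_differ)
  qed
  have "inj_on (\<lambda>(i, j). g i j) ({..<n} \<times> {..<n})"
  proof -
    have "i = i' \<and> j = j'"
      if lt: "i < n" "j < n" "i' < n" "j' < n" and eq: "g i j = g i' j'" for i j i' j'
    proof -
    have *: "g i j ! k = g i' j' ! k" for k using eq by simp
    from *[of i] *[of j] *[of j'] lt show "i = i' \<and> j = j'"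
      by (auto simp: nth split: if_splits)
    qed
    then show ?thesis by (auto simp: inj_on_def)
  qed
  then have card: "card A = n ^ 2"
    by (simp add: A_def card_image card_cartesian_product power2_eq_square)
  define V where "V = {hamming x y | x y. x \<in> A \<and> y \<in> A}"
  have "V = (\<lambda>(x, y). hamming x y) ` (A \<times> A)" by (auto simp: V_def)
  then have "finite V" by (simp add: A_def)
  moreover have "A \<noteq> {}" using assms by (auto simp: A_def)
  then have "V \<noteq> {}" by (auto simp: V_def)
  ultimately have "Max V \<in> V" by simp
  then have "Max V \<le> 4" using close by (auto simp: V_def A_def)
  moreover have "A \<subseteq> X n" by (auto simp: A_def g_def F_def intro!: star_in_X)
  then have "diameter_anticode (X n) hamming (Max V) A"
    using \<open>A \<noteq> {}\<close> by (simp add: diameter_anticode_def V_def)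
  ultimately show ?thesis using card by blast
qed

section \<open>The code\<close>

lemma in_odd_coset_flip_iff:
  assumes "p \<in> ext_hamming m n g" "i < n"
  shows "flip i p \<in> odd_coset m n h \<beta> \<longleftrightarrow> syndrome m n h (flip i p) = \<beta>"
  using assms by (auto simp: ext_hamming_def odd_coset_def parity_flip)

text \<open>This replaces the two definite descriptions in \<^const>\<open>R\<close> by a relation between \<open>p\<close> and the
  position of its star.\<close>

lemma R_eq_stars:
  assumes h: "bij_betw h {..<n} (F m)" and "\<beta> \<in> F m"
  shows "R (ext_hamming m n g) (odd_coset m n h \<beta>) =
    {star i p | i p. p \<in> ext_hamming m n g \<and> i < n \<and> flip i p \<in> odd_coset m n h \<beta>}"
proof -
  let ?Q = "odd_coset m n h \<beta>"
  have ex1: "\<exists>!i. i < n \<and> flip i p \<in> ?Q" if "p \<in> ext_hamming m n g" for p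
    using unique_flip_with_syndrome[OF h _ \<open>\<beta> \<in> F m\<close>, of p] that
    by (simp add: in_odd_coset_flip_iff[OF that] ext_hamming_def cong: conj_cong)
  have "star_diff p (neighbour ?Q p) = star i p"
    if p: "p \<in> ext_hamming m n g" and i: "i < n" "flip i p \<in> ?Q" for p i
  proof -
    have len: "length p = n" using p by (simp add: ext_hamming_def F_def)
    have "q \<in> ?Q \<and> hamming p q = 1 \<longleftrightarrow> q = flip i p" for q
    proof
      assume q: "q \<in> ?Q \<and> hamming p q = 1"
      then have "length q = length p" by (simp add: len odd_coset_def F_def)
      then show "q = flip i p" using hamming_1_iff_flip[of q p] q ex1[OF p] i len by auto
    qed (use i len hamming_1_iff_flip[of "flip i p" p] in auto)
    then have "neighbour ?Q p = flip i p" by (simp add: neighbour_def)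
    then show ?thesis using star_diff_flip i len by simp
  qed
  then have "star_diff p (neighbour ?Q p) = w \<longleftrightarrow> (\<exists>i. w = star i p \<and> i < n \<and> flip i p \<in> ?Q)"
    if "p \<in> ext_hamming m n g" for p w
    using ex1[OF that] that by metis
  then show ?thesis unfolding R_def set_eq_iff mem_Collect_eq by metis
qed

text \<open>Only a 4-set \<open>D\<close> of differing positions is dangerous. The APN property
  excludes equal stars, and the minimal distance of the odd coset, applied to
  the difference \<open>D - {i, i'}\<close>, excludes that both stars fall into \<open>D\<close>.\<close>

lemma hamming_star_ge_5:
  assumes \<alpha>: "bij_betw \<alpha> {..<n} (F m)" and APN: "APN m f" and f: "inj_on f (F m)"
    and p: "p \<in> ext_hamming m n \<alpha>" "p' \<in> ext_hamming m n \<alpha>" "p \<noteq> p'"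
    and i: "i < n" "i' < n"
    and q: "flip i p \<in> odd_coset m n (\<lambda>i. f (\<alpha> i)) \<beta>" "flip i' p' \<in> odd_coset m n (\<lambda>i. f (\<alpha> i)) \<beta>"
  shows "hamming (star i p) (star i' p') \<ge> 5"
proof -
  define D where "D = differ p p'"
  have len: "length p = n" "length p' = n" using p by (auto simp: ext_hamming_def F_def)
  have "D \<noteq> {}" using p(3) len by (simp add: D_def differ_empty_iff)
  have Dn: "D \<subseteq> {..<n}" by (auto simp: D_def differ_def len)
  have dep: "even_dependency m \<alpha> D"
    using p by (simp add: D_def ext_hamming_def even_dependency_differ_iff[of _ n])
  have \<alpha>S: "inj_on \<alpha> S" "\<alpha> ` S \<subseteq> F m" if "S \<subseteq> {..<n}" for S
    using \<alpha> that by (auto simp: bij_betw_def intro: inj_on_subset)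
  have f\<alpha>S: "inj_on (\<lambda>i. f (\<alpha> i)) S" "(\<lambda>i. f (\<alpha> i)) ` S \<subseteq> F m" if "S \<subseteq> {..<n}" for S
  proof -
    show "inj_on (\<lambda>i. f (\<alpha> i)) S"
      using comp_inj_on[OF \<alpha>S(1)[OF that] inj_on_subset[OF f \<alpha>S(2)[OF that]]]
      by (simp add: comp_def)
    have "f ` F m \<subseteq> F m" using APN by (auto simp: APN_def)
    then show "(\<lambda>i. f (\<alpha> i)) ` S \<subseteq> F m" using \<alpha>S(2)[OF that] by blast
  qed
  have "card D \<ge> 4"
    using even_dependency_card_ge_4[OF dep \<open>D \<noteq> {}\<close>] \<alpha>S[OF Dn] by blast
  moreover have "even (card D)" using dep by (simp add: even_dependency_def)
  then have "card D \<noteq> 5" by (intro notI) simp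
  ultimately consider "card D = 4" | "card D \<ge> 6" by linarith
  then show ?thesis
  proof cases
    case 1
    have depf: "even_dependency m (\<lambda>i. f (\<alpha> i)) (differ (flip i p) (flip i' p'))"
      using q by (simp add: odd_coset_def even_dependency_differ_iff[of _ n])
    have "i \<noteq> i'"
      using depf APN_no_common_even_dependency[OF APN _ _ dep] \<alpha>S[OF Dn] 1 i len
      by (auto simp: differ_flip_flip D_def)
    have "\<not> {i, i'} \<subseteq> D"
    proof
      assume sub: "{i, i'} \<subseteq> D"
      then have "differ (flip i p) (flip i' p') = D - {i, i'}"
        using i len \<open>i \<noteq> i'\<close> by (auto simp: differ_flip_flip D_def)
      moreover have card: "card (D - {i, i'}) = 2"
        using sub \<open>i \<noteq> i'\<close> 1 by (subst card_Diff_subset) auto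
      moreover have "D - {i, i'} \<noteq> {}" using card by force
      moreover have "D - {i, i'} \<subseteq> {..<n}" using Dn by blast
      ultimately show False
        using even_dependency_card_ge_4[of m "\<lambda>i. f (\<alpha> i)" "D - {i, i'}"] depf f\<alpha>S[of "D - {i, i'}"]
        by simp
    qed
    then have "D \<subset> D \<union> {i, i'}" by blast
    then have "card D < card (D \<union> {i, i'})" by (intro psubset_card_mono) (auto simp: D_def)
    then show ?thesis
      using 1 \<open>i \<noteq> i'\<close> i len by (simp add: hamming_eq_card_differ differ_star D_def)
  next
    case 2
    have "card (D - {i}) \<ge> card D - 1" by (simp add: card_Diff_singleton_if)
    moreover have "card D \<le> card (D \<union> {i, i'})" by (intro card_mono) (auto simp: D_def)
    ultimately have "card (D - {i}) \<ge> 5" "card (D \<union> {i, i'}) \<ge> 5" using 2 by linarith+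
    then show ?thesis
      using i len by (cases "i = i'") (simp_all add: hamming_eq_card_differ differ_star D_def)
  qed
qed

text \<open>Three distinct columns and their sum; the sum is a fourth column because two distinct columns
  do not add up to zero.\<close>

lemma even_dependency_4_containing:
  assumes \<alpha>: "bij_betw \<alpha> {..<n} (F m)" and "n \<ge> 4" "i < n"
  obtains S where "S \<subseteq> {..<n}" "i \<in> S" "card S = 4" "even_dependency m \<alpha> S"
proof -
  have "card ({..<n} - {i}) \<ge> 2" using assms by simp
  then obtain T where "T \<subseteq> {..<n} - {i}" "card T = 2" by (meson obtain_subset_with_card_n)
  then obtain j k where jk: "j < n" "k < n" "j \<noteq> i" "k \<noteq> i" "j \<noteq> k"
    by (auto simp: card_2_iff)
  have \<alpha>F: "\<alpha> l \<in> F m" if "l < n" for l using \<alpha> that by (auto simp: bij_betw_def)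
  have inj: "\<alpha> l = \<alpha> l' \<longleftrightarrow> l = l'" if "l < n" "l' < n" for l l'
    using \<alpha> that by (auto simp: bij_betw_def inj_on_def)
  have "add_word (\<alpha> i) (add_word (\<alpha> j) (\<alpha> k)) \<in> F m"
    using assms jk by (intro length_add_word \<alpha>F)
  then obtain l where l: "l < n" "\<alpha> l = add_word (\<alpha> i) (add_word (\<alpha> j) (\<alpha> k))"
    using \<alpha> by (metis bij_betw_imp_surj_on imageE lessThan_iff)
  have nth: "\<alpha> l ! t = \<alpha> i ! t + (\<alpha> j ! t + \<alpha> k ! t)" if "t < m" for t
    using l assms jk \<alpha>F that by (simp add: nth_add_word[of _ m] length_add_word)
  have ext: "u = v" if "u < n" "v < n" "\<And>t. t < m \<Longrightarrow> \<alpha> u ! t = \<alpha> v ! t" for u v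
    using inj[OF that(1,2)] \<alpha>F[OF that(1)] \<alpha>F[OF that(2)] that(3)
    by (simp add: F_def list_eq_iff_nth_eq)
  have add0: "a = b + (c + d) \<Longrightarrow> a = b \<Longrightarrow> c = d" "a = b + (c + d) \<Longrightarrow> a = c \<Longrightarrow> b = d"
    "a = b + (c + d) \<Longrightarrow> a = d \<Longrightarrow> b = c" for a b c d :: bit
    by (cases a; cases b; cases c; cases d; simp)+
  have "l \<noteq> i" using ext[of j k] jk add0(1)[OF nth] by auto
  moreover have "l \<noteq> j" using ext[of i k] jk \<open>i < n\<close> add0(2)[OF nth] by auto
  moreover have "l \<noteq> k" using ext[of i j] jk \<open>i < n\<close> add0(3)[OF nth] by auto
  moreover have zero: "b + (c + (d + (b + (c + d)))) = 0" for b c d :: bit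
    by (cases b; cases c; cases d; simp)
  ultimately have "card {i, j, k, l} = 4" "even_dependency m \<alpha> {i, j, k, l}"
    using jk nth by (auto simp: even_dependency_def)
  then show ?thesis using that[of "{i, j, k, l}"] assms jk l by auto
qed

lemma zero_in_ext_hamming: "zero_word n \<in> ext_hamming m n h"
proof -
  have "(\<Sum>i<n. zero_word n ! i * c i) = 0" for c
    by (intro sum.neutral) (auto simp: zero_word_def)
  from this[of "\<lambda>_. 1"] this[of "\<lambda>i. h i ! _"] show ?thesis
    by (auto simp: ext_hamming_def F_def zero_word_def syndrome_def list_eq_iff_nth_eq)
qed

text \<open>Let \<open>p\<close> and \<open>p'\<close> differ on a 4-set that contains the star position \<open>i\<close> of \<open>p\<close>. Then the
  two codewords differ at most on the 4-set and in the star position of \<open>p'\<close>, in at most five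
  places, and the lower bound makes it exactly five.\<close>

lemma hamming_star_eq_5_attained:
  assumes \<alpha>: "bij_betw \<alpha> {..<n} (F m)" and "n \<ge> 4" and h: "bij_betw h {..<n} (F m)"
    and \<beta>: "\<beta> \<in> F m"
    and ge: "\<And>p p' i i'. \<lbrakk>p \<in> ext_hamming m n \<alpha>; p' \<in> ext_hamming m n \<alpha>; p \<noteq> p'; i < n; i' < n;
      flip i p \<in> odd_coset m n h \<beta>; flip i' p' \<in> odd_coset m n h \<beta>\<rbrakk>
      \<Longrightarrow> hamming (star i p) (star i' p') \<ge> 5"
  shows "\<exists>p\<in>ext_hamming m n \<alpha>. \<exists>p'\<in>ext_hamming m n \<alpha>. \<exists>i<n. \<exists>i'<n. p \<noteq> p' \<and>
    flip i p \<in> odd_coset m n h \<beta> \<and> flip i' p' \<in> odd_coset m n h \<beta> \<and>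
    hamming (star i p) (star i' p') = 5"
proof -
  let ?P = "ext_hamming m n \<alpha>" and ?Q = "odd_coset m n h \<beta>"
  have ex: "\<exists>i<n. flip i p \<in> ?Q" if "p \<in> ?P" for p
    using unique_flip_with_syndrome[OF h _ \<beta>, of p] that in_odd_coset_flip_iff[OF that]
    by (auto simp: ext_hamming_def)
  define p where "p = zero_word n"
  have p: "p \<in> ?P" "length p = n" by (simp_all add: p_def zero_in_ext_hamming) (simp add: zero_word_def)
  obtain i where i: "i < n" "flip i p \<in> ?Q" using ex[OF p(1)] by blast
  obtain S where S: "S \<subseteq> {..<n}" "i \<in> S" "card S = 4" "even_dependency m \<alpha> S"
    using even_dependency_4_containing[OF \<alpha> \<open>n \<ge> 4\<close> i(1)] by blast
  define p' where "p' = map (\<lambda>k. p ! k + of_bool (k \<in> S)) [0..<n]"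
  have D: "differ p p' = S" using S(1) p(2) by (auto simp: differ_def p'_def)
  have len: "length p' = n" by (simp add: p'_def)
  have "p \<in> F n" using p by (simp add: F_def)
  then have "p' \<in> ?P"
    using even_dependency_differ_iff[of p n m \<alpha> p'] p(1) S(4) len
    unfolding D by (simp add: ext_hamming_def F_def)
  moreover have "p \<noteq> p'" using S(2) D by (auto simp: differ_def)
  ultimately have p': "p' \<in> ?P" "p \<noteq> p'" "length p' = n" using len by auto
  obtain i' where i': "i' < n" "flip i' p' \<in> ?Q" using ex[OF p'(1)] by blast
  have "hamming (star i p) (star i' p') = (if i = i' then 3 else card (insert i' S))"
    using i i' p p' D S by (auto simp: hamming_eq_card_differ differ_star insert_absorb)
  moreover have "card (insert i' S) \<le> 5" using card_insert_le_m1[of 5 S i'] S(3) by simp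
  moreover have "hamming (star i p) (star i' p') \<ge> 5" using ge p p' i i' by blast
  ultimately have "hamming (star i p) (star i' p') = 5" by (auto split: if_splits)
  then show ?thesis using p p' i i' by blast
qed

theorem theorem5p2:
  fixes m n :: nat and \<alpha> :: "nat \<Rightarrow> word" and f :: "word \<Rightarrow> word"
    and P Q :: "word set" and \<beta> :: word
  assumes "m \<ge> 2" and "n = 2 ^ m"
    and "bij_betw \<alpha> {..<n} (F m)"
    and "APN m f" and "inj_on f (F m)"
    and "P = ext_hamming m n \<alpha>"
    and "\<beta> \<in> F m" and "Q = odd_coset m n (\<lambda>i. f (\<alpha> i)) \<beta>"
  shows "diameter_perfect_code (X n) hamming 5 (R P Q)"
proof -
  let ?h = "\<lambda>i. f (\<alpha> i)"
  have "n \<ge> 4" using \<open>m \<ge> 2\<close> power_increasing[of 2 m "2::nat"] by (simp add: \<open>n = 2 ^ m\<close>)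
  have "f ` F m = F m"
    using \<open>APN m f\<close> \<open>inj_on f (F m)\<close> finite_F by (intro endo_inj_surj) (auto simp: APN_def)
  then have h: "bij_betw ?h {..<n} (F m)"
    using bij_betw_trans[OF \<open>bij_betw \<alpha> {..<n} (F m)\<close>, of f "F m"] \<open>inj_on f (F m)\<close>
    by (simp add: bij_betw_def comp_def)
  define C where "C = R P Q"
  have C: "C = {star i p | i p. p \<in> P \<and> i < n \<and> flip i p \<in> Q}"
    using R_eq_stars[OF h \<open>\<beta> \<in> F m\<close>] by (simp add: C_def assms(6,8))
  have PF: "P \<subseteq> F n" by (auto simp: assms(6) ext_hamming_def)
  then have "finite P" using finite_F finite_subset by blast
  have ge: "hamming (star i p) (star i' p') \<ge> 5"
    if "p \<in> P" "p' \<in> P" "p \<noteq> p'" "i < n" "i' < n" "flip i p \<in> Q" "flip i' p' \<in> Q" for p p' i i'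
    using hamming_star_ge_5[OF assms(3-5)] that by (simp add: assms(6,8))
  obtain p p' i i' where att: "p \<in> P" "p' \<in> P" "i < n" "i' < n" "p \<noteq> p'"
      "flip i p \<in> Q" "flip i' p' \<in> Q" "hamming (star i p) (star i' p') = 5"
    using hamming_star_eq_5_attained[OF assms(3) \<open>n \<ge> 4\<close> h \<open>\<beta> \<in> F m\<close>] ge
    unfolding assms(6,8) by blast
  have uniq: "\<exists>!i. i < n \<and> flip i p \<in> Q" if "p \<in> P" for p
    using unique_flip_with_syndrome[OF h _ \<open>\<beta> \<in> F m\<close>, of p] that PF
      in_odd_coset_flip_iff[of p m n \<alpha> _ ?h \<beta>]
    by (simp add: assms(6,8) subset_iff cong: conj_cong)
  have zero: "hamming w w = 0" for w :: "bit option list" by (simp add: hamming_def)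
  \<comment> \<open>The code is the injective image of \<open>P\<close>: equal codewords would have distance 0.\<close>
  define r where "r p = star (THE i. i < n \<and> flip i p \<in> Q) p" for p
  have r: "r p = star i p" if "p \<in> P" "i < n" "flip i p \<in> Q" for p i
    using the1_equality[OF uniq[OF that(1)]] that by (simp add: r_def)
  have "C = r ` P" using r uniq by (auto simp: C image_iff) metis+
  moreover have "inj_on r P"
  proof (rule inj_onI, rule ccontr)
    fix p p' assume *: "p \<in> P" "p' \<in> P" "r p = r p'" "p \<noteq> p'"
    then obtain i i' where "i < n" "flip i p \<in> Q" "i' < n" "flip i' p' \<in> Q" using uniq by metis
    then show False using ge[of p p' i i'] r * zero by auto
  qed
  ultimately have card: "card C = card P" and "finite C"
    using \<open>finite P\<close> by (simp_all add: card_image)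
  define V where "V = {hamming x y | x y. x \<in> C \<and> y \<in> C \<and> x \<noteq> y}"
  have "V \<subseteq> (\<lambda>(x, y). hamming x y) ` (C \<times> C)" by (auto simp: V_def)
  then have "finite V" using \<open>finite C\<close> finite_subset by blast
  have "{star i p, star i' p'} \<subseteq> C" using att C by blast
  moreover have ne: "star i p \<noteq> star i' p'" using att zero by auto
  ultimately have "5 \<in> V" unfolding V_def using att by (auto intro!: exI)
  moreover have "5 \<le> v" if "v \<in> V" for v
    using that ge uniq r unfolding V_def C by blast
  ultimately have min: "Min V = 5" using \<open>finite V\<close> by (intro Min_eqI) auto
  have "card C \<ge> 2"
    using card_mono[OF \<open>finite C\<close> \<open>{star i p, star i' p'} \<subseteq> C\<close>] ne by simp
  moreover have "C \<subseteq> X n" using PF by (auto simp: C intro: star_in_X)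
  ultimately have code: "distance_code (X n) hamming 5 C"
    using min by (simp add: distance_code_def V_def)
  obtain A D where A: "diameter_anticode (X n) hamming D A" "D \<le> 4" "card A = n ^ 2"
    using diameter_at_most_4_anticode_in_X[of n] \<open>n \<ge> 4\<close> by auto
  have "card C * card A = card (X n)"
    using card_X[of n] card_odd_words[OF assms(3)] A(3) card
    by (simp add: assms(6) power2_eq_square)
  then show ?thesis
    using code A(1,2) unfolding diameter_perfect_code_def C_def by fastforce
qed

end
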